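(* For $p\neq 0$ let $$x(p)=\frac{p^2-2+\sqrt{p^2(p^2-4)}}{2\sqrt{p^2(p^2-4)}},\qquad y_0(p)=\frac12\left(1+\frac{p^2}{\sqrt{p^2(p^2-4)}}\right),\qquad y(p)=\frac{p^2+\sqrt{p^2(p^2-4)}}{2p^2}.$$ Then $y_0(p)$, as a function of $x=x(p)$, is a solution of the Painlevé VI equation with parameters $(\alpha,\beta,\gamma,\delta)=(0,0,0,\tfrac12)$, and $y(p)$, as a function of $x=x(p)$, is a solution of the Painlevé VI equation with parameters $(\alpha,\beta,\gamma,\delta)=(\tfrac18,-\tfrac18,\tfrac18,\tfrac38)$.
   Context: The Painlevé VI equation with parameters $(\alpha,\beta,\gamma,\delta)\in\mathbb{C}^4$ is $$\frac{d^2 y}{dx^2}=\frac12\left(\frac1y+\frac1{y-1}+\frac1{y-x}\right)\left(\frac{dy}{dx}\right)^2-\left(\frac1x+\frac1{x-1}+\frac1{y-x}\right)\frac{dy}{dx}+\frac{y(y-1)(y-x)}{x^2(x-1)^2}\left(\alpha+\beta\frac{x}{y^2}+\gamma\frac{x-1}{(y-1)^2}+\delta\frac{x(x-1)}{(y-x)^2}\right).$$ The functions are considered locally as (possibly complex-valued) analytic functions of $p$, with the same fixed local branch of $\sqrt{p^2(p^2-4)}$ in all formulas, at values of $p$ for which all the expressions involved are defined; "as a function of $x(p)$" means via the local inverse of $p\mapsto x(p)$. *)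

theory Defs
  imports "HOL-Complex_Analysis.Complex_Analysis"
begin

definition painleve6_rhs ::
  "complex \<Rightarrow> complex \<Rightarrow> complex \<Rightarrow> complex \<Rightarrow> complex \<Rightarrow> complex \<Rightarrow> complex \<Rightarrow> complex" where
  "painleve6_rhs \<alpha> \<beta> \<gamma> \<delta> x y y' =
     1/2 * (1/y + 1/(y - 1) + 1/(y - x)) * y'\<^sup>2
     - (1/x + 1/(x - 1) + 1/(y - x)) * y'
     + y * (y - 1) * (y - x) / (x\<^sup>2 * (x - 1)\<^sup>2) *
       (\<alpha> + \<beta> * (x / y\<^sup>2) + \<gamma> * ((x - 1) / (y - 1)\<^sup>2) + \<delta> * (x * (x - 1) / (y - x)\<^sup>2))"

text \<open>Division by zero is total in HOL, so a solution is explicitly required to avoid all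
  singularities of the right-hand side.\<close>

definition solves_painleve6_on ::
  "complex \<Rightarrow> complex \<Rightarrow> complex \<Rightarrow> complex \<Rightarrow> (complex \<Rightarrow> complex) \<Rightarrow> complex set \<Rightarrow> bool" where
  "solves_painleve6_on \<alpha> \<beta> \<gamma> \<delta> y D \<longleftrightarrow>
     open D \<and> y holomorphic_on D \<and>
     (\<forall>x\<in>D. x \<noteq> 0 \<and> x \<noteq> 1 \<and> y x \<noteq> 0 \<and> y x \<noteq> 1 \<and> y x \<noteq> x \<and>
        (deriv ^^ 2) y x = painleve6_rhs \<alpha> \<beta> \<gamma> \<delta> x (y x) (deriv y x))"

text \<open>A curve \<open>p \<mapsto> (X p, Y p)\<close> on \<open>U\<close> is a parametrized solution if around every point of \<open>U\<close>
  the map \<open>X\<close> has a local inverse \<open>x \<mapsto> p\<close> and \<open>Y\<close>, composed with it, solves the equation.\<close>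

definition param_solves_painleve6_on ::
  "complex \<Rightarrow> complex \<Rightarrow> complex \<Rightarrow> complex \<Rightarrow>
   (complex \<Rightarrow> complex) \<Rightarrow> (complex \<Rightarrow> complex) \<Rightarrow> complex set \<Rightarrow> bool" where
  "param_solves_painleve6_on \<alpha> \<beta> \<gamma> \<delta> X Y U \<longleftrightarrow>
     (\<forall>p\<in>U. \<exists>V. open V \<and> p \<in> V \<and> V \<subseteq> U \<and> X holomorphic_on V \<and> inj_on X V \<and>
        solves_painleve6_on \<alpha> \<beta> \<gamma> \<delta> (Y \<circ> inv_into V X) (X ` V))"

text \<open>In the following, \<open>s\<close> is a branch of the square root of \<open>p\<^sup>2(p\<^sup>2 - 4)\<close>.\<close>

definition x_par :: "(complex \<Rightarrow> complex) \<Rightarrow> complex \<Rightarrow> complex" where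
  "x_par s p = (p\<^sup>2 - 2 + s p) / (2 * s p)"

definition y0_par :: "(complex \<Rightarrow> complex) \<Rightarrow> complex \<Rightarrow> complex" where
  "y0_par s p = 1/2 * (1 + p\<^sup>2 / s p)"

definition y_par :: "(complex \<Rightarrow> complex) \<Rightarrow> complex \<Rightarrow> complex" where
  "y_par s p = (p\<^sup>2 + s p) / (2 * p\<^sup>2)"

end

theory Submission
  imports Defs
begin

text \<open>Writing \<open>s\<close> for the square root, the chain rule turns everything into rational functions of
  \<open>p\<close> and \<open>s\<close>: one has \<open>dx/dp = -4p/s\<^sup>3\<close>, \<open>dy\<^sub>0/dx = p\<^sup>2/2\<close> and \<open>dy/dx = -(p\<^sup>2-4)/2\<close>, so the second
  derivatives with respect to \<open>x\<close> are \<open>-s\<^sup>3/4\<close> and \<open>s\<^sup>3/4\<close>. The equation itself collapses because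
  of the identities \<open>x(x-1) = 1/s\<^sup>2\<close>, \<open>y\<^sub>0(y\<^sub>0-1) = p\<^sup>2/s\<^sup>2\<close>, \<open>y(y-1) = -1/p\<^sup>2\<close>,
  \<open>y\<^sub>0-x = 1/s\<close> and \<open>y-x = -1/s\<close>.\<close>

section \<open>Differentiation with respect to \<open>x\<close> along a parametrized curve\<close>

text \<open>A local inverse of \<open>X\<close> has derivative \<open>1 / X'\<close>, so composing
  with it cancels the factor \<open>X'\<close>: \<open>F\<close> and \<open>G\<close> are the first
  and second derivatives of \<open>Y\<close> with respect to \<open>x\<close>, written as functions
  of \<open>p\<close>. Thus the differential equation becomes a pointwise identity in
  \<open>p\<close>.\<close>

lemma param_solves_painleve6_onI:
  fixes X Y F G X' :: "complex \<Rightarrow> complex"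
  assumes U: "open U"
    and dX: "\<And>p. p \<in> U \<Longrightarrow> (X has_field_derivative X' p) (at p)"
    and dY: "\<And>p. p \<in> U \<Longrightarrow> (Y has_field_derivative F p * X' p) (at p)"
    and dF: "\<And>p. p \<in> U \<Longrightarrow> (F has_field_derivative G p * X' p) (at p)"
    and nz: "\<And>p. p \<in> U \<Longrightarrow> X' p \<noteq> 0"
    and reg: "\<And>p. p \<in> U \<Longrightarrow> X p \<noteq> 0 \<and> X p \<noteq> 1 \<and> Y p \<noteq> 0 \<and> Y p \<noteq> 1 \<and> Y p \<noteq> X p"
    and eq: "\<And>p. p \<in> U \<Longrightarrow> G p = painleve6_rhs \<alpha> \<beta> \<gamma> \<delta> (X p) (Y p) (F p)"
  shows "param_solves_painleve6_on \<alpha> \<beta> \<gamma> \<delta> X Y U"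
  unfolding param_solves_painleve6_on_def
proof
  fix p assume p: "p \<in> U"
  have hX: "X holomorphic_on U"
    using dX U by (auto simp: holomorphic_on_open)
  have "deriv X p \<noteq> 0"
    using dX[OF p] nz[OF p] by (simp add: DERIV_imp_deriv)
  then obtain r where r: "r > 0" "ball p r \<subseteq> U" "inj_on X (ball p r)"
    using has_complex_derivative_locally_injective[OF hX p U] by metis
  define V where "V = ball p r"
  define g where "g = inv_into V X"
  have V: "open V" "p \<in> V" "V \<subseteq> U" "inj_on X V"
    using r by (auto simp: V_def)
  have hXV: "X holomorphic_on V" using hX V(3) holomorphic_on_subset by blast
  have oD: "open (X ` V)"
    using open_mapping_thm3[OF hXV V(1,4)] .
  have gX: "g (X q) = q" if "q \<in> V" for q
    using V(4) that by (simp add: g_def)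
  \<comment> \<open>The definition speaks of \<open>inv_into\<close>, whose holomorphy is not
    immediate. The holomorphic inverse \<open>h\<close> agrees with \<open>g\<close> on the open
    image of \<open>V\<close>, so its derivative passes to \<open>g\<close>.\<close>
  obtain h where h: "h holomorphic_on (X ` V)"
      "\<And>z. z \<in> V \<Longrightarrow> deriv X z * deriv h (X z) = 1" "\<And>z. z \<in> V \<Longrightarrow> h (X z) = z"
    using holomorphic_has_inverse[OF hXV V(1,4)] by metis
  have dg: "(g has_field_derivative inverse (X' q)) (at (X q))" if q: "q \<in> V" for q
  proof -
    have "(h has_field_derivative deriv h (X q)) (at (X q))"
      using h(1) oD q by (simp add: holomorphic_derivI)
    then have "(g has_field_derivative deriv h (X q)) (at (X q))"
      by (rule has_field_derivative_transform_within_open[OF _ oD]) (use q gX h(3) in auto)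
    moreover have "deriv h (X q) = inverse (X' q)"
      using h(2)[OF q] dX[of q] V(3) q DERIV_imp_deriv
      by (metis inverse_unique subsetD)
    ultimately show ?thesis by simp
  qed
  have chain: "(A \<circ> g has_field_derivative B) (at (X q))"
    if "q \<in> V" "(A has_field_derivative B * X' q) (at q)" for A B q
  proof -
    have "(A \<circ> g has_field_derivative (B * X' q) * inverse (X' q)) (at (X q))"
      using that gX dg by (intro DERIV_chain) auto
    then show ?thesis using nz[of q] V(3) that(1) by (auto simp: mult.assoc)
  qed
  have dYg: "(Y \<circ> g has_field_derivative F q) (at (X q))" if "q \<in> V" for q
    using chain[OF that] dY[of q] V(3) that by auto
  have dFg: "(F \<circ> g has_field_derivative G q) (at (X q))" if "q \<in> V" for q
    using chain[OF that] dF[of q] V(3) that by auto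
  have d2: "(deriv ^^ 2) (Y \<circ> g) (X q) = G q" if q: "q \<in> V" for q
  proof -
    \<comment> \<open>Differentiating a second time needs \<open>deriv (Y o g)\<close> near the
      point, not only at it: it equals \<open>F o g\<close> on the whole open image of
      \<open>V\<close>.\<close>
    have "(deriv (Y \<circ> g) has_field_derivative G q) (at (X q))"
      using dFg[OF q] oD
      by (rule has_field_derivative_transform_within_open) (use q gX dYg in \<open>auto simp: DERIV_imp_deriv[OF dYg]\<close>)
    then show ?thesis by (simp add: numeral_2_eq_2 DERIV_imp_deriv)
  qed
  have "solves_painleve6_on \<alpha> \<beta> \<gamma> \<delta> (Y \<circ> g) (X ` V)"
    unfolding solves_painleve6_on_def
  proof (intro conjI ballI)
    show "(Y \<circ> g) holomorphic_on X ` V"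
      using dYg oD by (auto simp: holomorphic_on_open)
  next
    fix x assume "x \<in> X ` V"
    then obtain q where q: "q \<in> V" "x = X q" by auto
    have qU: "q \<in> U" using q V(3) by auto
    show "x \<noteq> 0" "x \<noteq> 1" "(Y \<circ> g) x \<noteq> 0" "(Y \<circ> g) x \<noteq> 1" "(Y \<circ> g) x \<noteq> x"
      using reg[OF qU] q gX by auto
    show "(deriv ^^ 2) (Y \<circ> g) x
        = painleve6_rhs \<alpha> \<beta> \<gamma> \<delta> x ((Y \<circ> g) x) (deriv (Y \<circ> g) x)"
      using d2[OF q(1)] eq[OF qU] dYg[OF q(1)] gX[OF q(1)] q(2) by (simp add: DERIV_imp_deriv)
  qed (fact oD)
  then show "\<exists>V. open V \<and> p \<in> V \<and> V \<subseteq> U \<and> X holomorphic_on V \<and> inj_on X V \<and>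
        solves_painleve6_on \<alpha> \<beta> \<gamma> \<delta> (Y \<circ> inv_into V X) (X ` V)"
    using V hXV unfolding g_def by blast
qed

text \<open>Pairing the poles at 0 and 1 leaves, apart from the \<beta> and \<gamma> terms, only
  \<open>2x-1\<close>, \<open>2y-1\<close>, \<open>x(x-1)\<close>, \<open>y(y-1)\<close> and
  \<open>y-x\<close>, which are all simple in \<open>p\<close> and \<open>s\<close> on both
  curves.\<close>

lemma painleve6_rhs_eq:
  assumes "x \<noteq> 0" "x \<noteq> 1" "y \<noteq> 0" "y \<noteq> 1" "y \<noteq> x"
  shows "painleve6_rhs \<alpha> \<beta> \<gamma> \<delta> x y y' =
    1/2 * ((2 * y - 1) / (y * (y - 1)) + 1 / (y - x)) * y'\<^sup>2
    - ((2 * x - 1) / (x * (x - 1)) + 1 / (y - x)) * y'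
    + y * (y - 1) * (y - x) / (x * (x - 1))\<^sup>2 *
      (\<alpha> + (\<beta> * x * (y - 1)\<^sup>2 + \<gamma> * (x - 1) * y\<^sup>2) / (y * (y - 1))\<^sup>2
       + \<delta> * (x * (x - 1)) / (y - x)\<^sup>2)"
proof -
  have "1/z + 1/(z - 1) = (2 * z - 1) / (z * (z - 1))" if "z \<noteq> 0" "z \<noteq> 1" for z :: complex
    using that by (simp add: field_simps)
  moreover have "\<beta> * (x / y\<^sup>2) + \<gamma> * ((x - 1) / (y - 1)\<^sup>2)
      = (\<beta> * x * (y - 1)\<^sup>2 + \<gamma> * (x - 1) * y\<^sup>2) / (y * (y - 1))\<^sup>2"
    using assms by (simp add: add_frac_eq power_mult_distrib)
  ultimately show ?thesis
    using assms by (simp add: painleve6_rhs_def power_mult_distrib add.assoc[symmetric])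
qed

section \<open>Derivatives of the branch and of the three parametrizing functions\<close>

context
  fixes U :: "complex set" and s :: "complex \<Rightarrow> complex"
  assumes U: "open U"
    and s_hol: "s holomorphic_on U"
    and s_sq: "\<And>p. p \<in> U \<Longrightarrow> (s p)\<^sup>2 = p\<^sup>2 * (p\<^sup>2 - 4)"
    and p_nz: "\<And>p. p \<in> U \<Longrightarrow> p \<noteq> 0"
    and s_nz: "\<And>p. p \<in> U \<Longrightarrow> s p \<noteq> 0"
begin

text \<open>Implicit differentiation: \<open>s^2\<close> is differentiated once through
  \<open>s\<close> and once as a polynomial in \<open>p\<close>, and \<open>2 s\<close> is
  cancelled.\<close>

lemma s_has_derivative:
  assumes p: "p \<in> U"
  shows "(s has_field_derivative 2 * p * (p\<^sup>2 - 2) / s p) (at p)"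
proof -
  have s': "(s has_field_derivative deriv s p) (at p)"
    using s_hol U p by (rule holomorphic_derivI)
  have "((\<lambda>q. (s q)\<^sup>2) has_field_derivative 2 * s p * deriv s p) (at p)"
    by (rule derivative_eq_intros s' refl | simp)+
  moreover have "((\<lambda>q. (s q)\<^sup>2) has_field_derivative 4 * p ^ 3 - 8 * p) (at p)"
  proof (rule has_field_derivative_transform_within_open[OF _ U p])
    show "((\<lambda>q. q\<^sup>2 * (q\<^sup>2 - 4)) has_field_derivative 4 * p ^ 3 - 8 * p) (at p)"
      by (rule derivative_eq_intros refl | simp add: algebra_simps power_numeral_reduce)+
  qed (simp add: s_sq)
  ultimately have "2 * s p * deriv s p = 4 * p ^ 3 - 8 * p"
    by (rule DERIV_unique)
  then have "s p * deriv s p = 2 * p * (p\<^sup>2 - 2)"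
    by algebra
  then have "deriv s p = 2 * p * (p\<^sup>2 - 2) / s p"
    using s_nz[OF p] by (simp add: eq_divide_eq mult.commute)
  then show ?thesis using s' by simp
qed

lemma x_par_has_derivative:
  assumes p: "p \<in> U"
  shows "(x_par s has_field_derivative - 4 * p / s p ^ 3) (at p)"
proof -
  have "(x_par s has_field_derivative
      ((2 * p + 2 * p * (p\<^sup>2 - 2) / s p) * (2 * s p)
        - (p\<^sup>2 - 2 + s p) * (2 * (2 * p * (p\<^sup>2 - 2) / s p))) / (2 * s p * (2 * s p))) (at p)"
    (is "(_ has_field_derivative ?D) _")
    unfolding x_par_def
    by (rule derivative_eq_intros s_has_derivative[OF p] refl | simp add: s_nz p)+
  also have "?D = (p * (s p)\<^sup>2 - p * (p\<^sup>2 - 2)\<^sup>2) / s p ^ 3"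
    using s_nz[OF p] by (simp add: field_simps power_numeral_reduce)
  also have "p * (s p)\<^sup>2 - p * (p\<^sup>2 - 2)\<^sup>2 = - 4 * p"
    unfolding s_sq[OF p] by algebra
  finally show ?thesis .
qed

text \<open>The factor \<open>-4p/s^3\<close> is \<open>dx/dp\<close>; keeping it separate exhibits
  the cofactor as \<open>dy0/dx\<close>.\<close>

lemma y0_par_has_derivative:
  assumes p: "p \<in> U"
  shows "(y0_par s has_field_derivative p\<^sup>2 / 2 * (- 4 * p / s p ^ 3)) (at p)"
proof -
  have "(y0_par s has_field_derivative
      1/2 * ((2 * p * s p - p\<^sup>2 * (2 * p * (p\<^sup>2 - 2) / s p)) / (s p * s p))) (at p)"
    (is "(_ has_field_derivative ?D) _")
    unfolding y0_par_def
    by (rule derivative_eq_intros s_has_derivative[OF p] refl | simp add: s_nz p)+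
  also have "?D = (p * (s p)\<^sup>2 - p ^ 3 * (p\<^sup>2 - 2)) / s p ^ 3"
    using s_nz[OF p] by (simp add: field_simps power_numeral_reduce)
  also have "p * (s p)\<^sup>2 - p ^ 3 * (p\<^sup>2 - 2) = p\<^sup>2 / 2 * (- 4 * p)"
    unfolding s_sq[OF p] by (simp add: field_simps power_numeral_reduce)
  finally show ?thesis by simp
qed

lemma y_par_has_derivative:
  assumes p: "p \<in> U"
  shows "(y_par s has_field_derivative - (p\<^sup>2 - 4) / 2 * (- 4 * p / s p ^ 3)) (at p)"
proof -
  note nz = s_nz[OF p] p_nz[OF p]
  have "(y_par s has_field_derivative
      ((2 * p + 2 * p * (p\<^sup>2 - 2) / s p) * (2 * p\<^sup>2) - (p\<^sup>2 + s p) * (4 * p))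
        / (2 * p\<^sup>2 * (2 * p\<^sup>2))) (at p)"
    (is "(_ has_field_derivative ?D) _")
    unfolding y_par_def
    by (rule derivative_eq_intros s_has_derivative[OF p] refl | simp add: nz)+
  also have "?D = (p\<^sup>2 * (p\<^sup>2 - 2) - (s p)\<^sup>2) / (p ^ 3 * s p)"
    using nz by (simp add: field_simps power_numeral_reduce)
  also have "\<dots> = 2 / (p * s p)"
    unfolding s_sq[OF p] using nz by (simp add: field_simps power_numeral_reduce)
  \<comment> \<open>Expanding by \<open>s^2\<close> produces the denominator \<open>s^3\<close> of
    \<open>dx/dp\<close>; replacing the new \<open>s^2\<close> above by \<open>p^2(p^2-4)\<close>
    then gives the factor \<open>p^2-4\<close>.\<close>
  also have "\<dots> = 2 * (s p)\<^sup>2 / (p * s p ^ 3)"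
    using nz by (simp add: field_simps power_numeral_reduce)
  also have "\<dots> = - (p\<^sup>2 - 4) / 2 * (- 4 * p / s p ^ 3)"
    unfolding s_sq[OF p] using nz by (simp add: field_simps power_numeral_reduce)
  finally show ?thesis .
qed

section \<open>Algebraic identities on the two curves\<close>

text \<open>Centering at 1/2 makes \<open>2z-1\<close> a simple quotient for each of the three
  functions, and \<open>z(z-1) = ((2z-1)^2-1)/4\<close> then yields the products. Their numerators
  collapse through \<open>(p^2-2)^2 - s^2 = 4\<close> and \<open>p^4 - s^2 = 4p^2\<close>.\<close>

lemma par_identities:
  assumes p: "p \<in> U"
  shows "2 * x_par s p - 1 = (p\<^sup>2 - 2) / s p"
    and "x_par s p * (x_par s p - 1) = 1 / (s p)\<^sup>2"
    and "2 * y0_par s p - 1 = p\<^sup>2 / s p"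
    and "y0_par s p * (y0_par s p - 1) = p\<^sup>2 / (s p)\<^sup>2"
    and "y0_par s p - x_par s p = 1 / s p"
    and "2 * y_par s p - 1 = s p / p\<^sup>2"
    and "y_par s p * (y_par s p - 1) = - 1 / p\<^sup>2"
    and "y_par s p - x_par s p = - 1 / s p"
proof -
  note nz = s_nz[OF p] p_nz[OF p]
  have prod: "z * (z - 1) = ((2 * z - 1)\<^sup>2 - 1) / 4" for z :: complex
    by (simp add: field_simps power2_eq_square)
  have frac: "(v / w - 1) / 4 = (v - w) / 4 / w" if "w \<noteq> 0" for v w :: complex
    using that by (simp add: field_simps)
  have num_x: "(p\<^sup>2 - 2)\<^sup>2 - (s p)\<^sup>2 = 4" and num_y: "p ^ 4 - (s p)\<^sup>2 = 4 * p\<^sup>2"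
    unfolding s_sq[OF p] by (simp_all add: algebra_simps power_numeral_reduce)
  have num_y': "(s p)\<^sup>2 - p ^ 4 = - 4 * p\<^sup>2"
    using num_y by (simp add: algebra_simps)
  show x: "2 * x_par s p - 1 = (p\<^sup>2 - 2) / s p"
    and y0: "2 * y0_par s p - 1 = p\<^sup>2 / s p"
    and y: "2 * y_par s p - 1 = s p / p\<^sup>2"
    using nz by (simp_all add: x_par_def y0_par_def y_par_def field_simps)
  show "x_par s p * (x_par s p - 1) = 1 / (s p)\<^sup>2"
    unfolding prod x power_divide using nz by (simp add: frac num_x)
  show "y0_par s p * (y0_par s p - 1) = p\<^sup>2 / (s p)\<^sup>2"
    unfolding prod y0 power_divide using nz by (simp add: frac num_y)
  show "y_par s p * (y_par s p - 1) = - 1 / p\<^sup>2"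
    unfolding prod y power_divide using nz
    by (simp add: frac num_y') (simp add: power_numeral_reduce)
  show "y0_par s p - x_par s p = 1 / s p"
    using nz by (simp add: x_par_def y0_par_def field_simps)
  \<comment> \<open>By the relation for \<open>s^2\<close>, the numerator over the common
    denominator is \<open>-2p^2\<close>.\<close>
  have "y_par s p - x_par s p = ((s p)\<^sup>2 - p\<^sup>2 * (p\<^sup>2 - 2)) / (2 * p\<^sup>2 * s p)"
    using nz by (simp add: x_par_def y_par_def field_simps power2_eq_square)
  also have "\<dots> = - 1 / s p"
    unfolding s_sq[OF p] using nz by (simp add: field_simps power_numeral_reduce)
  finally show "y_par s p - x_par s p = - 1 / s p" .
qed

text \<open>A nonzero product \<open>z(z-1)\<close> excludes both values 0 and 1, and a nonzero
  difference excludes a collision with \<open>x\<close>.\<close>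

lemma par_regular:
  assumes p: "p \<in> U"
  shows "x_par s p \<noteq> 0 \<and> x_par s p \<noteq> 1 \<and> y0_par s p \<noteq> 0 \<and> y0_par s p \<noteq> 1 \<and> y0_par s p \<noteq> x_par s p"
    and "x_par s p \<noteq> 0 \<and> x_par s p \<noteq> 1 \<and> y_par s p \<noteq> 0 \<and> y_par s p \<noteq> 1 \<and> y_par s p \<noteq> x_par s p"
  using par_identities(2,4,5,7,8)[OF p] s_nz[OF p] p_nz[OF p] by auto

section \<open>Verification of the two equations\<close>

lemma y0_par_equation:
  assumes p: "p \<in> U"
  shows "- (s p ^ 3) / 4 = painleve6_rhs 0 0 0 (1/2) (x_par s p) (y0_par s p) (p\<^sup>2 / 2)"
proof -
  note nz = s_nz[OF p] p_nz[OF p]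
  \<comment> \<open>The three summands come, in order, from the term quadratic in the derivative,
    the linear term and the \<delta> term, each with one factor \<open>s\<close> taken out.\<close>
  have "painleve6_rhs 0 0 0 (1/2) (x_par s p) (y0_par s p) (p\<^sup>2 / 2)
      = s p * (p ^ 4 / 4 - (p\<^sup>2 - 1) * p\<^sup>2 / 2 + p\<^sup>2 / 2)"
    using nz by (simp add: painleve6_rhs_eq par_regular[OF p] par_identities[OF p])
      (simp add: field_simps power_numeral_reduce)
  also have "\<dots> = - (s p * (p\<^sup>2 * (p\<^sup>2 - 4))) / 4"
    by (simp add: field_simps power_numeral_reduce)
  also have "\<dots> = - (s p ^ 3) / 4"
    unfolding s_sq[OF p, symmetric] by (simp add: power_numeral_reduce)
  finally show ?thesis by simp
qed

lemma y_par_equation: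
  assumes p: "p \<in> U"
  shows "s p ^ 3 / 4
    = painleve6_rhs (1/8) (-1/8) (1/8) (3/8) (x_par s p) (y_par s p) (- (p\<^sup>2 - 4) / 2)"
proof -
  note nz = s_nz[OF p] p_nz[OF p]
  have "-1/8 * x * (y - 1)\<^sup>2 + 1/8 * (x - 1) * y\<^sup>2 = (x * (x - 1) - (y - x)\<^sup>2) / 8"
    for x y :: complex
    by (simp add: field_simps power2_eq_square)
  \<comment> \<open>The \<beta> and \<gamma> contributions cancel because \<open>x(x-1)\<close> and
    \<open>(y-x)^2\<close> both equal \<open>1/s^2\<close>.\<close>
  then have cancel: "-1/8 * x_par s p * (y_par s p - 1)\<^sup>2 + 1/8 * (x_par s p - 1) * (y_par s p)\<^sup>2 = 0"
    by (simp only: par_identities(2,8)[OF p]) (simp add: power_divide)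
  have reg: "x_par s p \<noteq> 0" "x_par s p \<noteq> 1" "y_par s p \<noteq> 0" "y_par s p \<noteq> 1" "y_par s p \<noteq> x_par s p"
    using par_regular(2)[OF p] by auto
  \<comment> \<open>The same equality \<open>x(x-1) = (y-x)^2\<close> reduces the last bracket to
    \<open>1/8 + 3/8 = 1/2\<close>, which gives the summand \<open>s^2/(2p^2)\<close>.\<close>
  have "painleve6_rhs (1/8) (-1/8) (1/8) (3/8) (x_par s p) (y_par s p) (- (p\<^sup>2 - 4) / 2)
      = s p * (- (p\<^sup>2 - 4)\<^sup>2 / 4 + (p\<^sup>2 - 3) * (p\<^sup>2 - 4) / 2 + (s p)\<^sup>2 / (2 * p\<^sup>2))"
    unfolding painleve6_rhs_eq[OF reg] cancel par_identities[OF p]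
    using nz by (simp add: field_simps power_numeral_reduce)
  also have "\<dots> = s p * (p\<^sup>2 * (p\<^sup>2 - 4)) / 4"
    unfolding s_sq[OF p] using nz by (simp add: field_simps power_numeral_reduce)
  also have "\<dots> = s p ^ 3 / 4"
    unfolding s_sq[OF p, symmetric] by (simp add: power_numeral_reduce)
  finally show ?thesis by simp
qed

lemma param_solves_y0_par: "param_solves_painleve6_on 0 0 0 (1/2) (x_par s) (y0_par s) U"
proof (rule param_solves_painleve6_onI[OF U x_par_has_derivative y0_par_has_derivative _ _
      par_regular(1) y0_par_equation])
  fix p assume p: "p \<in> U"
  \<comment> \<open>The derivative of \<open>p^2/2\<close> is \<open>p\<close>; dividing it by
    \<open>dx/dp\<close> gives the second derivative \<open>-s^3/4\<close>.\<close>
  show "((\<lambda>p. p\<^sup>2 / 2) has_field_derivative - (s p ^ 3) / 4 * (- 4 * p / s p ^ 3)) (at p)"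
    by (rule derivative_eq_intros refl | simp add: s_nz p)+
  show "- 4 * p / s p ^ 3 \<noteq> 0" using s_nz p_nz p by simp
qed

lemma param_solves_y_par:
  "param_solves_painleve6_on (1/8) (-1/8) (1/8) (3/8) (x_par s) (y_par s) U"
proof (rule param_solves_painleve6_onI[OF U x_par_has_derivative y_par_has_derivative _ _
      par_regular(2) y_par_equation])
  fix p assume p: "p \<in> U"
  show "((\<lambda>p. - (p\<^sup>2 - 4) / 2) has_field_derivative s p ^ 3 / 4 * (- 4 * p / s p ^ 3)) (at p)"
    by (rule derivative_eq_intros refl | simp add: s_nz p)+
  show "- 4 * p / s p ^ 3 \<noteq> 0" using s_nz p_nz p by simp
qed

end

theorem theorem5p3:
  fixes U :: "complex set" and s :: "complex \<Rightarrow> complex"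
  assumes "open U"
    and "s holomorphic_on U"
    and "\<And>p. p \<in> U \<Longrightarrow> (s p)\<^sup>2 = p\<^sup>2 * (p\<^sup>2 - 4)"
    and "\<And>p. p \<in> U \<Longrightarrow> p \<noteq> 0"
    and "\<And>p. p \<in> U \<Longrightarrow> s p \<noteq> 0"
  shows "param_solves_painleve6_on 0 0 0 (1/2) (x_par s) (y0_par s) U \<and>
         param_solves_painleve6_on (1/8) (-1/8) (1/8) (3/8) (x_par s) (y_par s) U"
  using param_solves_y0_par[OF assms] param_solves_y_par[OF assms] by blast

end
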